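(* Let $\mathcal{P}$ be a profile of $n$ votes on a set $\mathcal{A}$ of $m$ alternatives and let $d\in\mathcal{A}$. Then the Dodgson Relaxed (DR) score $\mathrm{Sc}_{\mathbf R}$, the Dodgson Clone (DC) score $\mathrm{Sc}_{\mathbf C}$ and the Dodgson Relaxed and Rounded (D&) score $\mathrm{Sc}_{\mathbf \&}$ are bounded as follows: $$\mathrm{Sc}_{\mathbf D}(d)-(m-1)!\,(m-1)\,e<\mathrm{Sc}_{\mathbf C}(d)\le \mathrm{Sc}_{\mathbf R}(d)\le \mathrm{Sc}_{\mathbf \&}(d)\le \mathrm{Sc}_{\mathbf D}(d),$$ where $\mathrm{Sc}_{\mathbf D}$ is the Dodgson score and $e=2.71\ldots$ is the exponential constant.
   Context: Let $\mathcal{A}$ be a finite set of $m$ alternatives. A profile is an array $\mathcal{P}=(P_1,\ldots,P_n)$ of $n$ votes, one for each agent, each vote being a linear order of $\mathcal{A}$; $xP_iy$ means that the $i$-th vote ranks $x$ above $y$. Put $n_{xy}=\#\{i\mid xP_iy\}$ and $\mathrm{adv}(a,b)=\max(0,n_{ab}-n_{ba})$. An alternative $a$ is a Condorcet-tie winner if $\mathrm{adv}(b,a)=0$ for all other alternatives $b$. Dodgson score: $\mathrm{Sc}_{\mathbf D}(a)$ is the minimum number of swaps of neighbouring alternatives (within votes) required to make $a$ a Condorcet-tie winner. DC score: let $\mathcal{P}^k$ be the profile in which each agent of $\mathcal{P}$ is replaced by $k$ clones. Then $\mathrm{Sc}_{\mathbf C}(a)=\min_{k\ge 1}\frac{\mathrm{Sc}_{\mathbf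 D}[\mathcal{P}^k](a)}{k}$, where $\mathrm{Sc}_{\mathbf D}[\mathcal{P}^k](a)$ is the Dodgson score of $a$ in $\mathcal{P}^k$. Equivalently, it is the Dodgson score when votes may be split into rational fractions and swaps may be made on those fractions (a swap on a fraction $w$ of a vote costs $w$). DR score: $\mathrm{Sc}_{\mathbf R}(a)$ is defined as the Dodgson score, but votes may be split into rational fractions (a swap on a fraction $w$ of a vote counts $w$), and it is required that, for each $b\ne a$, $a$ be swapped over $b$ at least $F(b,a)=\lceil \mathrm{adv}(b,a)/2\rceil$ times in total. Explicitly, it is the minimum of $\sum_{i,j} j\,x_{ij}$ over rational $x_{ij}\ge 0$ (with $i$ ranging over the votes and $x_{ij}$ the fraction of vote $i$ in which $a$ is moved up $j$ positions) subject to $\sum_j x_{ij}=1$ for each $i$ and $\sum_{i,j}e_{ijb}x_{ij}\ge F(b,a)$ for each $b\neq a$, where $e_{ijb}=1$ if moving $a$ up $j$ positions in vote $i$ raises $a$ above $b$ and $e_{ijb}=0$ otherwise. D& score: $\mathrm{Sc}_{\mathbf \&}(a)=\lceil \mathrm{Sc}_{\mathbf R}(a)\rceil$.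
   Formalization: The first, strict inequality is asserted only for m ≥ 2, because for m = 1 all scores and the term (m−1)!(m−1)e are 0 and it would read 0 < 0; the other three inequalities are asserted for every m. *)

theory Defs
  imports Complex_Main "HOL-Combinatorics.Multiset_Permutations"
begin

text \<open>
  A linear order of the finite set \<open>A\<close> is represented by the list of the elements of \<open>A\<close>
  without repetition, most preferred alternative first, i.e. by an element of
  \<^term>\<open>permutations_of_set A\<close>. A profile is a list of such votes, one entry for each agent.
\<close>

type_synonym 'a vote = "'a list"
type_synonym 'a profile = "'a vote list"

definition is_profile :: "'a set \<Rightarrow> 'a profile \<Rightarrow> bool" where
  "is_profile A P \<longleftrightarrow> (\<forall>v\<in>set P. v \<in> permutations_of_set A)"

definition prefers :: "'a vote \<Rightarrow> 'a \<Rightarrow> 'a \<Rightarrow> bool" where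
  "prefers v x y \<longleftrightarrow> (\<exists>i j. i < j \<and> j < length v \<and> v ! i = x \<and> v ! j = y)"

definition num_prefer :: "'a profile \<Rightarrow> 'a \<Rightarrow> 'a \<Rightarrow> nat" where
  "num_prefer P x y = card {i. i < length P \<and> prefers (P ! i) x y}"

definition adv :: "'a profile \<Rightarrow> 'a \<Rightarrow> 'a \<Rightarrow> int" where
  "adv P a b = max 0 (int (num_prefer P a b) - int (num_prefer P b a))"

definition condorcet_tie_winner :: "'a set \<Rightarrow> 'a profile \<Rightarrow> 'a \<Rightarrow> bool" where
  "condorcet_tie_winner A P a \<longleftrightarrow> a \<in> A \<and> (\<forall>b\<in>A - {a}. adv P b a = 0)"

definition neighbour_swap :: "'a vote \<Rightarrow> 'a vote \<Rightarrow> bool" where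
  "neighbour_swap v w \<longleftrightarrow> (\<exists>xs x y ys. v = xs @ [x, y] @ ys \<and> w = xs @ [y, x] @ ys)"

definition profile_swap :: "'a profile \<Rightarrow> 'a profile \<Rightarrow> bool" where
  "profile_swap P Q \<longleftrightarrow> (\<exists>i<length P. \<exists>w. neighbour_swap (P ! i) w \<and> Q = P[i := w])"

definition dodgson_score :: "'a set \<Rightarrow> 'a profile \<Rightarrow> 'a \<Rightarrow> nat" where
  "dodgson_score A P a = (LEAST t. \<exists>Q. (profile_swap ^^ t) P Q \<and> condorcet_tie_winner A Q a)"

definition clone_profile :: "nat \<Rightarrow> 'a profile \<Rightarrow> 'a profile" where
  "clone_profile k P = concat (map (replicate k) P)"

text \<open>
  The minima defining \<open>dc_score\<close> and \<open>dr_score\<close> are written as infima in the reals. When \<open>P\<close> is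
  a profile on \<open>A\<close> and \<open>a \<in> A\<close>, both sets are nonempty and bounded below by 0, and their infima
  are attained, because a linear program with rational data has a rational optimal solution.
\<close>

definition dc_score :: "'a set \<Rightarrow> 'a profile \<Rightarrow> 'a \<Rightarrow> real" where
  "dc_score A P a = (INF k\<in>{1..}. real (dodgson_score A (clone_profile k P) a) / real k)"

definition num_above :: "'a vote \<Rightarrow> 'a \<Rightarrow> nat" where
  "num_above v a = length (takeWhile (\<lambda>x. x \<noteq> a) v)"

text \<open>The vote \<open>v\<close> with \<open>a\<close> moved up \<open>j\<close> positions, for \<open>j \<le> num_above v a\<close>.\<close>

definition move_up :: "'a \<Rightarrow> nat \<Rightarrow> 'a vote \<Rightarrow> 'a vote" where
  "move_up a j v =
     take (num_above v a - j) (remove1 a v) @ [a] @ drop (num_above v a - j) (remove1 a v)"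

definition raises_over :: "'a vote \<Rightarrow> 'a \<Rightarrow> nat \<Rightarrow> 'a \<Rightarrow> rat" where
  "raises_over v a j b = (if prefers v b a \<and> prefers (move_up a j v) a b then 1 else 0)"

definition required_swaps :: "'a profile \<Rightarrow> 'a \<Rightarrow> 'a \<Rightarrow> int" where
  "required_swaps P b a = \<lceil>of_int (adv P b a) / (2 :: rat)\<rceil>"

text \<open>
  \<open>x i j\<close> is the fraction of vote \<open>i\<close> in which \<open>a\<close> is moved up \<open>j\<close> positions; here \<open>j\<close> ranges
  over the moves that are possible in vote \<open>i\<close>.
\<close>

definition dr_feasible :: "'a set \<Rightarrow> 'a profile \<Rightarrow> 'a \<Rightarrow> (nat \<Rightarrow> nat \<Rightarrow> rat) \<Rightarrow> bool" where
  "dr_feasible A P a x \<longleftrightarrow>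
     (\<forall>i<length P. \<forall>j\<le>num_above (P ! i) a. x i j \<ge> 0) \<and>
     (\<forall>i<length P. (\<Sum>j\<le>num_above (P ! i) a. x i j) = 1) \<and>
     (\<forall>b\<in>A - {a}. (\<Sum>i<length P. \<Sum>j\<le>num_above (P ! i) a. raises_over (P ! i) a j b * x i j)
                    \<ge> of_int (required_swaps P b a))"

definition dr_cost :: "'a profile \<Rightarrow> 'a \<Rightarrow> (nat \<Rightarrow> nat \<Rightarrow> rat) \<Rightarrow> rat" where
  "dr_cost P a x = (\<Sum>i<length P. \<Sum>j\<le>num_above (P ! i) a. of_nat j * x i j)"

definition dr_score :: "'a set \<Rightarrow> 'a profile \<Rightarrow> 'a \<Rightarrow> real" where
  "dr_score A P a = Inf {of_rat (dr_cost P a x) | x. dr_feasible A P a x}"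

definition d_and_score :: "'a set \<Rightarrow> 'a profile \<Rightarrow> 'a \<Rightarrow> int" where
  "d_and_score A P a = \<lceil>dr_score A P a\<rceil>"

end

theory Submission
  imports Defs
begin

text \<open>
  Only the list \<open>t\<close> of alternatives ranked above \<open>d\<close> in a vote, its type, matters for the scores
  of \<open>d\<close>: lifting \<open>d\<close> by \<open>j\<close> positions makes it overtake \<open>b\<close> exactly if \<open>0 < lead t b \<le> j\<close>, where
  \<open>lead t b\<close> counts the positions from \<open>b\<close> down to \<open>d\<close>. Conversely a swap of neighbours
  shortens such a distance by at most one, so a vote in which \<open>b\<close> ends up below \<open>d\<close> has received
  at least \<open>lead t b\<close> swaps. Hence nothing is gained by swaps that do not lift \<open>d\<close>, and the Dodgson
  score is the optimum of an integer program: choose lifts \<open>j i\<close> of minimal sum so that \<open>d\<close> overtakes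
  every \<open>b\<close> at least \<open>adv P b d / 2\<close> times (\<open>dodgson_score_le\<close>, \<open>optimal_lifting_plan\<close>).

  The relaxed score is the rational relaxation of this program with the right-hand sides rounded up.
  As the number of overtakings in an integer solution is an integer, the rounding excludes none of
  them, so the relaxed score, and then its ceiling, is at most the Dodgson score. On the other hand a
  rational solution with common denominator \<open>k\<close> is an integral solution for \<open>k\<close> clones, at \<open>k\<close> times
  the cost, which gives \<open>dc_score_le_dr_score\<close>.

  For the lower bound, averaging a solution for \<open>k\<close> clones over the clones of each vote gives a
  fractional solution for \<open>P\<close> (\<open>clone_tail_plan\<close>). It can be made integral cheaply: let \<open>Y t r\<close> be the
  total fraction of votes of type \<open>t\<close> that are lifted by at least \<open>r\<close>. Overtaking numbers
  and cost are sums of these quantities. Replacing each \<open>Y t r\<close> by its ceiling keeps it decreasing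
  in \<open>r\<close>, so there are lifts with exactly these counts (\<open>staircase_assignment\<close>); no
  overtaking is lost, and the cost grows by at most \<open>length t\<close> for each type. A type is a list
  without repetition over the \<open>m - 1\<close> alternatives other than \<open>d\<close>. Hence its length is at most
  \<open>m - 1\<close>, and there are at most \<open>(m - 1)! * (1 / 0! + ... + 1 / (m - 1)!) < (m - 1)! * e\<close> types
  (\<open>sum_length_types_less\<close>). The bound does not depend on \<open>k\<close>, so strictness survives the infimum.

  Clones and fractions are both handled by \<open>dodgson_score_clone_le_rounding\<close>, which rounds a
  fractional solution to an integral one for \<open>q\<close> clones: \<open>q = 1\<close> gives the lower bound, and for \<open>q\<close> a
  common denominator the rounding is exact.
\<close>

section \<open>Positions in a vote\<close>

definition upper_part :: "'a \<Rightarrow> 'a vote \<Rightarrow> 'a list" where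
  "upper_part d v = takeWhile (\<lambda>x. x \<noteq> d) v"

text \<open>
  If \<open>b\<close> occurs in the list \<open>t\<close> of alternatives above \<open>d\<close>, then \<open>lead t b\<close> is the number of positions
  by which \<open>d\<close> has to be lifted to overtake \<open>b\<close>; otherwise it is 0, because \<^const>\<open>num_above\<close> then
  returns the length of \<open>t\<close>.
\<close>

definition lead :: "'a list \<Rightarrow> 'a \<Rightarrow> nat" where
  "lead t b = length t - num_above t b"

lemma num_above_Nil [simp]: "num_above [] z = 0"
  by (simp add: num_above_def)

lemma num_above_Cons [simp]:
  "num_above (x # xs) z = (if x = z then 0 else Suc (num_above xs z))"
  by (simp add: num_above_def)

lemma num_above_append:
  "num_above (xs @ ys) z = (if z \<in> set xs then num_above xs z else length xs + num_above ys z)"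
  by (induction xs) auto

lemma num_above_less: "z \<in> set xs \<Longrightarrow> num_above xs z < length xs"
  by (induction xs) auto

lemma num_above_notin: "z \<notin> set xs \<Longrightarrow> num_above xs z = length xs"
  by (induction xs) auto

lemma nth_num_above: "z \<in> set xs \<Longrightarrow> xs ! num_above xs z = z"
  by (induction xs) auto

lemma num_above_eq_length: "num_above v d = length (upper_part d v)"
  by (simp add: num_above_def upper_part_def)

lemma vote_split:
  assumes "d \<in> set v"
  obtains s where "v = upper_part d v @ d # s" and "d \<notin> set (upper_part d v)"
proof -
  obtain ys zs where yz: "v = ys @ d # zs" "d \<notin> set ys"
    using assms by (meson split_list_first)
  have "upper_part d v = ys"
    using yz by (auto simp: upper_part_def takeWhile_append)
  then show thesis using yz that by blast
qed

lemma prefers_iff_num_above: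
  assumes "distinct v" "x \<in> set v" "y \<in> set v"
  shows "prefers v x y \<longleftrightarrow> num_above v x < num_above v y"
proof
  assume "prefers v x y"
  then obtain i j where ij: "i < j" "j < length v" "v ! i = x" "v ! j = y"
    by (auto simp: prefers_def)
  have "i = num_above v x" "j = num_above v y"
    using ij assms nth_eq_iff_index_eq[of v] num_above_less nth_num_above
    by (metis order.strict_trans)+
  then show "num_above v x < num_above v y" using ij by simp
next
  assume "num_above v x < num_above v y"
  then show "prefers v x y"
    unfolding prefers_def using assms num_above_less nth_num_above by metis
qed

lemma num_above_eq_iff:
  assumes "x \<in> set v" "y \<in> set v"
  shows "num_above v x = num_above v y \<longleftrightarrow> x = y"
  using assms nth_num_above by metis

lemma lead_upper_part:
  assumes "d \<in> set v" "b \<noteq> d"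
  shows "lead (upper_part d v) b = num_above v d - num_above v b"
proof -
  obtain s where s: "v = upper_part d v @ d # s" "d \<notin> set (upper_part d v)"
    using vote_split assms(1) by metis
  have "num_above v b = (if b \<in> set (upper_part d v) then num_above (upper_part d v) b
          else length (upper_part d v) + num_above (d # s) b)"
    by (subst s(1)) (rule num_above_append)
  then show ?thesis
    using assms(2) by (auto simp: lead_def num_above_eq_length[of v d] num_above_notin)
qed

lemma lead_le: "lead t b \<le> length t"
  by (simp add: lead_def)

lemma move_up_split:
  assumes "d \<notin> set t"
  shows "move_up d j (t @ d # s) = take (length t - j) t @ d # drop (length t - j) t @ s"
proof -
  have "num_above (t @ d # s) d = length t"
    using assms by (simp add: num_above_append)
  then show ?thesis
    using assms by (simp add: move_up_def remove1_append)
qed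

lemma mset_move_up: "d \<in> set v \<Longrightarrow> mset (move_up d j v) = mset v"
proof -
  assume "d \<in> set v"
  then obtain s where s: "v = upper_part d v @ d # s" "d \<notin> set (upper_part d v)"
    using vote_split by metis
  define t where "t = upper_part d v"
  have "mset (take (length t - j) t) + mset (drop (length t - j) t) = mset t"
    by (metis append_take_drop_id mset_append)
  then have "mset (move_up d j (t @ d # s)) = mset (t @ d # s)"
    using s(2) by (simp add: move_up_split t_def)
  then show ?thesis using s(1) t_def by simp
qed

lemma move_up_permutation:
  assumes "v \<in> permutations_of_set A" "d \<in> A"
  shows "move_up d j v \<in> permutations_of_set A"
proof -
  have "d \<in> set v" using assms by (simp add: permutations_of_set_def)
  then have "mset (move_up d j v) = mset v" by (rule mset_move_up)
  then have "set (move_up d j v) = set v" "distinct (move_up d j v) = distinct v"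
    using mset_eq_setD mset_eq_imp_distinct_iff by blast+
  then show ?thesis using assms by (simp add: permutations_of_set_def)
qed

lemma prefers_total:
  assumes "v \<in> permutations_of_set A" "d \<in> A" "b \<in> A" "b \<noteq> d"
  shows "prefers v d b \<longleftrightarrow> \<not> prefers v b d"
proof -
  have v: "distinct v" "d \<in> set v" "b \<in> set v"
    using assms by (auto simp: permutations_of_set_def)
  then have "num_above v b \<noteq> num_above v d"
    using num_above_eq_iff assms(4) by metis
  then show ?thesis using v by (auto simp: prefers_iff_num_above)
qed

lemma prefers_iff_lead:
  assumes "v \<in> permutations_of_set A" "d \<in> A" "b \<in> A" "b \<noteq> d"
  shows "prefers v b d \<longleftrightarrow> 0 < lead (upper_part d v) b"
proof -
  have v: "distinct v" "d \<in> set v" "b \<in> set v"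
    using assms by (auto simp: permutations_of_set_def)
  then show ?thesis using assms(4) by (simp add: lead_upper_part prefers_iff_num_above)
qed

lemma lead_move_up:
  assumes "d \<in> set v" "b \<noteq> d"
  shows "lead (upper_part d (move_up d j v)) b = lead (upper_part d v) b - j"
proof -
  obtain s where s: "v = upper_part d v @ d # s" "d \<notin> set (upper_part d v)"
    using vote_split assms(1) by metis
  define t where "t = upper_part d v"
  define k where "k = length t - j"
  have tk: "d \<notin> set (take k t)"
    using s(2) t_def by (metis in_set_takeD)
  have "move_up d j v = take k t @ d # drop k t @ s"
    using s move_up_split t_def k_def by metis
  then have ab: "upper_part d (move_up d j v) = take k t"
    using tk by (auto simp: upper_part_def takeWhile_append)
  have kl: "k \<le> length t" by (simp add: k_def)
  have nt: "num_above t b = (if b \<in> set (take k t) then num_above (take k t) b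
               else k + num_above (drop k t) b)"
    using num_above_append[of "take k t" "drop k t" b] kl by simp
  show ?thesis
  proof (cases "b \<in> set (take k t)")
    case True
    then have "num_above (take k t) b < k" using num_above_less kl by fastforce
    then show ?thesis using True nt kl unfolding ab t_def[symmetric]
      by (auto simp: lead_def k_def)
  next
    case False
    then show ?thesis using nt kl unfolding ab t_def[symmetric]
      by (auto simp: lead_def k_def num_above_notin)
  qed
qed

text \<open>
  The overtaking coefficients of the linear program are thresholds in \<open>j\<close> that depend on the vote
  only through its type.
\<close>

lemma raises_over_iff_lead:
  assumes "v \<in> permutations_of_set A" "d \<in> A" "b \<in> A" "b \<noteq> d"
  shows "raises_over v d j b =
           (if 0 < lead (upper_part d v) b \<and> lead (upper_part d v) b \<le> j then 1 else 0)"
proof -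
  have dv: "d \<in> set v" using assms by (simp add: permutations_of_set_def)
  have m: "move_up d j v \<in> permutations_of_set A"
    using assms move_up_permutation by metis
  show ?thesis
    unfolding raises_over_def prefers_total[OF m assms(2-4)]
      prefers_iff_lead[OF m assms(2-4)] prefers_iff_lead[OF assms]
    using lead_move_up[OF dv assms(4)] by simp
qed

section \<open>Sequences of neighbour swaps\<close>

text \<open>
  A swap moves two alternatives by one place each. The distance would change by two only if both \<open>x\<close>
  and \<open>y\<close> moved, but then they are neighbours, and the truncated difference passes between 1 and 0.
\<close>

lemma neighbour_swap_num_above:
  assumes "neighbour_swap v w" "distinct v"
  shows "num_above v x - num_above v y \<le> Suc (num_above w x - num_above w y)"
proof -
  obtain xs a b ys where v: "v = xs @ [a, b] @ ys" and w: "w = xs @ [b, a] @ ys"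
    using assms(1) by (auto simp: neighbour_swap_def)
  have "a \<noteq> b" using v assms(2) by simp
  then show ?thesis
    using assms(2) num_above_less[of x xs] num_above_less[of y xs]
    unfolding v w by (auto simp: num_above_append)
qed

lemma neighbour_swap_mset: "neighbour_swap v w \<Longrightarrow> mset w = mset v"
  by (auto simp: neighbour_swap_def)

lemma neighbour_swap_permutation:
  assumes "neighbour_swap v w" "v \<in> permutations_of_set A"
  shows "w \<in> permutations_of_set A"
proof -
  have "mset w = mset v" using assms(1) by (rule neighbour_swap_mset)
  then have "set w = set v" "distinct w = distinct v"
    using mset_eq_setD mset_eq_imp_distinct_iff by blast+
  then show ?thesis using assms by (simp add: permutations_of_set_def)
qed

lemma relpow_neighbour_swap:
  assumes "(neighbour_swap ^^ t) v w" "v \<in> permutations_of_set A"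
  shows "w \<in> permutations_of_set A \<and>
         num_above v x - num_above v y \<le> t + (num_above w x - num_above w y)"
  using assms(1)
proof (induction t arbitrary: w)
  case 0
  then show ?case using assms(2) by simp
next
  case (Suc t)
  then obtain u where u: "(neighbour_swap ^^ t) v u" "neighbour_swap u w"
    by auto
  from Suc.IH[OF u(1)] have IH: "u \<in> permutations_of_set A"
    "num_above v x - num_above v y \<le> t + (num_above u x - num_above u y)" by auto
  have "distinct u" using IH(1) by (simp add: permutations_of_set_def)
  then show ?case
    using IH neighbour_swap_permutation[OF u(2) IH(1)]
      neighbour_swap_num_above[OF u(2), of x y] by auto
qed

text \<open>
  By the preceding lemma the truncated distance from \<open>b\<close> down to \<open>d\<close> serves as a potential: it starts
  at the lead, ends at 0, and no swap lowers it by more than one.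
\<close>

lemma lead_le_swaps:
  assumes "(neighbour_swap ^^ t) v w" "v \<in> permutations_of_set A" "d \<in> A" "b \<in> A" "b \<noteq> d"
    and "\<not> prefers w b d"
  shows "lead (upper_part d v) b \<le> t"
proof -
  have w: "w \<in> permutations_of_set A"
    and le: "num_above v d - num_above v b \<le> t + (num_above w d - num_above w b)"
    using relpow_neighbour_swap[OF assms(1,2)] by blast+
  have "lead (upper_part d w) b = 0"
    using assms(6) prefers_iff_lead[OF w assms(3-5)] by simp
  moreover have "d \<in> set v" "d \<in> set w"
    using assms w by (auto simp: permutations_of_set_def)
  ultimately show ?thesis using le assms(5) by (simp add: lead_upper_part)
qed

lemma swaps_to_front:
  "(neighbour_swap ^^ length ys) (xs @ ys @ d # zs) (xs @ d # ys @ zs)"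
proof (induction ys arbitrary: zs rule: rev_induct)
  case Nil
  then show ?case by simp
next
  case (snoc y ys)
  have "neighbour_swap (xs @ (ys @ [y]) @ d # zs) (xs @ ys @ d # y # zs)"
    unfolding neighbour_swap_def
    by (rule exI[of _ "xs @ ys"], rule exI[of _ y], rule exI[of _ d], rule exI[of _ zs]) simp
  moreover have "(neighbour_swap ^^ length ys) (xs @ ys @ d # y # zs) (xs @ d # (ys @ [y]) @ zs)"
    using snoc.IH[of "y # zs"] by simp
  ultimately show ?case by (metis length_append_singleton relpowp_Suc_I2)
qed

lemma swaps_move_up:
  assumes "d \<in> set v" "j \<le> num_above v d"
  shows "(neighbour_swap ^^ j) v (move_up d j v)"
proof -
  obtain s where s: "v = upper_part d v @ d # s" "d \<notin> set (upper_part d v)"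
    using vote_split assms(1) by metis
  define t where "t = upper_part d v"
  define k where "k = length t - j"
  have j: "length (drop k t) = j"
    using assms(2) by (simp add: k_def t_def num_above_eq_length)
  have "move_up d j v = take k t @ d # drop k t @ s"
    using s move_up_split t_def k_def by metis
  moreover have "v = take k t @ drop k t @ d # s"
    using s(1) t_def by (metis append.assoc append_take_drop_id)
  ultimately show ?thesis using swaps_to_front[of "drop k t" "take k t" d s] j by metis
qed

lemma profile_swaps_single:
  assumes "(neighbour_swap ^^ t) (P ! i) w" "i < length P"
  shows "(profile_swap ^^ t) P (P[i := w])"
  using assms(1)
proof (induction t arbitrary: w)
  case 0
  then show ?case by auto
next
  case (Suc t)
  then obtain u where u: "(neighbour_swap ^^ t) (P ! i) u" "neighbour_swap u w" by auto
  have "profile_swap (P[i := u]) (P[i := w])"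
    unfolding profile_swap_def using assms(2) u(2)
    by (intro exI[of _ i]) auto
  then show ?case using Suc.IH[OF u(1)] by auto
qed

lemma profile_swaps_all:
  assumes "\<And>i. i < length P \<Longrightarrow> (neighbour_swap ^^ t i) (P ! i) (w i)"
  shows "(profile_swap ^^ (\<Sum>i<length P. t i)) P (map w [0..<length P])"
proof -
  have "(profile_swap ^^ (\<Sum>i<s. t i)) P (map w [0..<s] @ drop s P)" if "s \<le> length P" for s
    using that
  proof (induction s)
    case 0
    then show ?case by simp
  next
    case (Suc s)
    let ?R = "map w [0..<s] @ drop s P"
    have l: "s < length ?R" using Suc.prems by simp
    have "?R ! s = P ! s" using Suc.prems by (simp add: nth_append)
    then have "(profile_swap ^^ t s) ?R (?R[s := w s])"
      using profile_swaps_single[OF _ l] assms Suc.prems by simp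
    moreover have "?R[s := w s] = map w [0..<Suc s] @ drop (Suc s) P"
      using Suc.prems by (simp add: list_update_append Cons_nth_drop_Suc[symmetric])
    moreover have "(profile_swap ^^ (\<Sum>i<s. t i)) P ?R" using Suc by simp
    ultimately show ?case by (simp add: relpowp_add) (metis relcomppI)
  qed
  from this[of "length P"] show ?thesis by simp
qed

text \<open>
  Swaps in different votes do not interact, so a sequence of profile swaps is determined, as far as
  its result and length are concerned, by one sequence for each vote.
\<close>

lemma profile_swaps_split:
  assumes "(profile_swap ^^ t) P Q"
  shows "length Q = length P \<and>
         (\<exists>f. (\<Sum>i<length P. f i) = t \<and> (\<forall>i<length P. (neighbour_swap ^^ f i) (P ! i) (Q ! i)))"
  using assms
proof (induction t arbitrary: Q)
  case 0
  then show ?case by (auto intro!: exI[of _ "\<lambda>_. 0"])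
next
  case (Suc t)
  then obtain R where R: "(profile_swap ^^ t) P R" "profile_swap R Q" by auto
  from Suc.IH[OF R(1)] obtain f where f: "length R = length P" "(\<Sum>i<length P. f i) = t"
    "\<forall>i<length P. (neighbour_swap ^^ f i) (P ! i) (R ! i)" by auto
  obtain i w where i: "i < length R" "neighbour_swap (R ! i) w" "Q = R[i := w]"
    using R(2) by (auto simp: profile_swap_def)
  define g where "g = f(i := Suc (f i))"
  have "(\<Sum>k<length P. g k) = (\<Sum>k<length P. f k + (if k = i then 1 else 0))"
    by (rule sum.cong) (auto simp: g_def)
  also have "\<dots> = Suc t" using i(1) f by (simp add: sum.distrib)
  finally have "(\<Sum>k<length P. g k) = Suc t" .
  moreover have "(neighbour_swap ^^ g k) (P ! k) (Q ! k)" if "k < length P" for k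
    using f i that by (cases "k = i") (auto simp: g_def)
  ultimately show ?case using f(1) i(3) by auto
qed

section \<open>The Dodgson score as an integer program\<close>

definition lifted_votes :: "'a profile \<Rightarrow> 'a \<Rightarrow> (nat \<Rightarrow> nat) \<Rightarrow> 'a \<Rightarrow> nat set" where
  "lifted_votes P d j b =
     {i. i < length P \<and> 0 < lead (upper_part d (P ! i)) b \<and> lead (upper_part d (P ! i)) b \<le> j i}"

text \<open>
  The feasible solutions of the integer program for the Dodgson score; the factor 2 avoids halving
  the advantage, so that the same condition serves odd and even advantages.
\<close>

definition lifting_plan :: "'a set \<Rightarrow> 'a profile \<Rightarrow> 'a \<Rightarrow> (nat \<Rightarrow> nat) \<Rightarrow> bool" where
  "lifting_plan A P d j \<longleftrightarrow>
     (\<forall>i<length P. j i \<le> num_above (P ! i) d) \<and>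
     (\<forall>b\<in>A - {d}. adv P b d \<le> 2 * int (card (lifted_votes P d j b)))"

lemma profile_nth: "is_profile A P \<Longrightarrow> i < length P \<Longrightarrow> P ! i \<in> permutations_of_set A"
  by (simp add: is_profile_def)

lemma finite_lifted_votes [simp]: "finite (lifted_votes P d j b)"
  by (simp add: lifted_votes_def)

lemma adv_eq:
  assumes "is_profile A P" "d \<in> A" "b \<in> A" "b \<noteq> d"
  shows "adv P b d = max 0 (2 * int (num_prefer P b d) - int (length P))"
proof -
  let ?B = "{i. i < length P \<and> prefers (P ! i) b d}"
  have "{i. i < length P \<and> prefers (P ! i) d b} = {..<length P} - ?B"
    using prefers_total[OF profile_nth[OF assms(1)] assms(2-4)] by auto
  then have "num_prefer P d b = length P - num_prefer P b d"
    unfolding num_prefer_def by (simp add: card_Diff_subset subset_eq)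
  moreover have "num_prefer P b d \<le> length P"
    unfolding num_prefer_def using card_mono[of "{..<length P}" ?B] by auto
  ultimately show ?thesis by (simp add: adv_def of_nat_diff)
qed

text \<open>
  Each lifted vote moves from the supporters of \<open>b\<close> to those of \<open>d\<close> and so lowers the difference
  by 2. The advantage is that difference cut off at 0, hence vanishes once half of it is made up.
\<close>

lemma lifting_plan_reaches:
  assumes "is_profile A P" "d \<in> A" "lifting_plan A P d j"
  shows "\<exists>Q. (profile_swap ^^ (\<Sum>i<length P. j i)) P Q \<and> condorcet_tie_winner A Q d"
proof -
  let ?w = "\<lambda>i. move_up d (j i) (P ! i)"
  let ?Q = "map ?w [0..<length P]"
  have dP: "d \<in> set (P ! i)" if "i < length P" for i
    using profile_nth[OF assms(1) that] assms(2) by (simp add: permutations_of_set_def)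
  have reach: "(profile_swap ^^ (\<Sum>i<length P. j i)) P ?Q"
    using assms(3) dP by (intro profile_swaps_all swaps_move_up) (auto simp: lifting_plan_def)
  have Q: "is_profile A ?Q"
    using move_up_permutation[OF profile_nth[OF assms(1)] assms(2)] by (auto simp: is_profile_def)
  have "adv ?Q b d = 0" if b: "b \<in> A - {d}" for b
  proof -
    let ?X = "{i. i < length P \<and> prefers (P ! i) b d}"
    let ?Y = "{i. i < length P \<and> prefers (?Q ! i) b d}"
    have "?Y = ?X - lifted_votes P d j b"
      using b prefers_iff_lead[OF profile_nth[OF assms(1)] assms(2), of _ b]
        prefers_iff_lead[OF profile_nth[OF Q] assms(2), of _ b] lead_move_up[OF dP, of _ b]
      by (auto simp: lifted_votes_def)
    moreover have sub: "lifted_votes P d j b \<subseteq> ?X"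
      using b prefers_iff_lead[OF profile_nth[OF assms(1)] assms(2), of _ b]
      by (auto simp: lifted_votes_def)
    ultimately have "card ?Y = card ?X - card (lifted_votes P d j b)"
      by (simp add: card_Diff_subset)
    moreover have "card (lifted_votes P d j b) \<le> card ?X"
      using sub by (simp add: card_mono)
    moreover have "adv P b d \<le> 2 * int (card (lifted_votes P d j b))"
      using assms(3) b by (auto simp: lifting_plan_def)
    ultimately show ?thesis
      using b adv_eq[OF assms(1,2)] adv_eq[OF Q assms(2)]
      by (auto simp: num_prefer_def of_nat_diff)
  qed
  then have "condorcet_tie_winner A ?Q d"
    using assms(2) by (simp add: condorcet_tie_winner_def)
  then show ?thesis using reach by blast
qed

lemma dodgson_score_le:
  assumes "is_profile A P" "d \<in> A" "lifting_plan A P d j"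
  shows "dodgson_score A P d \<le> (\<Sum>i<length P. j i)"
  unfolding dodgson_score_def using lifting_plan_reaches[OF assms] by (intro Least_le)

lemma full_lifting_plan:
  assumes "is_profile A P" "d \<in> A"
  shows "lifting_plan A P d (\<lambda>i. num_above (P ! i) d)"
proof -
  have "{i. i < length P \<and> prefers (P ! i) b d} =
        lifted_votes P d (\<lambda>i. num_above (P ! i) d) b" if "b \<in> A - {d}" for b
    using that prefers_iff_lead[OF profile_nth[OF assms(1)] assms(2), of _ b]
    by (auto simp: lifted_votes_def num_above_eq_length lead_le)
  then show ?thesis
    by (auto simp: lifting_plan_def adv_def num_prefer_def)
qed

text \<open>
  Lifting \<open>d\<close> in each vote by as many positions as swaps were made there, or to the top if there
  are fewer, overtakes at least the alternatives that fell behind \<open>d\<close>. Hence an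
  optimal swap sequence yields a plan of no larger cost.
\<close>

lemma optimal_lifting_plan:
  assumes "is_profile A P" "d \<in> A"
  obtains j where "lifting_plan A P d j" "(\<Sum>i<length P. j i) \<le> dodgson_score A P d"
proof -
  let ?reach = "\<lambda>t. \<exists>Q. (profile_swap ^^ t) P Q \<and> condorcet_tie_winner A Q d"
  \<comment> \<open>Lifting \<open>d\<close> to the top of every vote shows that the least number of swaps is attained.\<close>
  have "?reach (\<Sum>i<length P. num_above (P ! i) d)"
    using lifting_plan_reaches[OF assms full_lifting_plan[OF assms]] .
  then have "?reach (dodgson_score A P d)"
    unfolding dodgson_score_def by (rule LeastI)
  then obtain Q where Q: "(profile_swap ^^ dodgson_score A P d) P Q"
    and win: "condorcet_tie_winner A Q d" by blast
  obtain f where len: "length Q = length P" and f: "(\<Sum>i<length P. f i) = dodgson_score A P d"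
    and sw: "\<And>i. i < length P \<Longrightarrow> (neighbour_swap ^^ f i) (P ! i) (Q ! i)"
    using profile_swaps_split[OF Q] by blast
  have pQ: "is_profile A Q"
    using relpow_neighbour_swap[OF sw profile_nth[OF assms(1)]] len
    by (auto simp: is_profile_def in_set_conv_nth)
  define j where "j = (\<lambda>i. min (f i) (num_above (P ! i) d))"
  have "adv P b d \<le> 2 * int (card (lifted_votes P d j b))" if b: "b \<in> A - {d}" for b
  proof -
    let ?X = "{i. i < length P \<and> prefers (P ! i) b d}"
    let ?Y = "{i. i < length P \<and> prefers (Q ! i) b d}"
    have "?X \<subseteq> ?Y \<union> lifted_votes P d j b"
      using b prefers_iff_lead[OF profile_nth[OF assms(1)] assms(2), of _ b]
        lead_le_swaps[OF sw profile_nth[OF assms(1)] assms(2), of _ b]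
      by (auto simp: lifted_votes_def j_def num_above_eq_length lead_le)
    then have "card ?X \<le> card (?Y \<union> lifted_votes P d j b)"
      by (intro card_mono) auto
    also have "\<dots> \<le> card ?Y + card (lifted_votes P d j b)"
      by (rule card_Un_le)
    finally have "card ?X \<le> card ?Y + card (lifted_votes P d j b)" .
    moreover have "adv Q b d = 0"
      using win b by (simp add: condorcet_tie_winner_def)
    ultimately show ?thesis
      using b adv_eq[OF assms(1,2), of b] adv_eq[OF pQ assms(2), of b] len
      by (auto simp: num_prefer_def)
  qed
  then have "lifting_plan A P d j" by (auto simp: lifting_plan_def j_def)
  moreover have "(\<Sum>i<length P. j i) \<le> dodgson_score A P d"
    unfolding f[symmetric] by (rule sum_mono) (simp add: j_def)
  ultimately show thesis by (rule that)
qed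

section \<open>Realising prescribed numbers of lifted votes\<close>

lemma sum_eq_sum_card_levels:
  fixes j :: "'b \<Rightarrow> nat"
  assumes "finite I" "\<And>i. i \<in> I \<Longrightarrow> j i \<le> L"
  shows "(\<Sum>i\<in>I. j i) = (\<Sum>r=1..L. card {i\<in>I. r \<le> j i})"
proof -
  have "(\<Sum>i\<in>I. j i) = (\<Sum>i\<in>I. card {r\<in>{1..L}. r \<le> j i})"
  proof (rule sum.cong)
    fix i assume "i \<in> I"
    then have "{r\<in>{1..L}. r \<le> j i} = {1..j i}" using assms(2) by fastforce
    then show "j i = card {r\<in>{1..L}. r \<le> j i}" by simp
  qed simp
  also have "\<dots> = (\<Sum>r=1..L. card {i\<in>I. r \<le> j i})"
    using assms(1) by (intro sum_multicount_gen) auto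
  finally show ?thesis .
qed

text \<open>
  Number the members of \<open>I\<close> from 0 and draw column \<open>r\<close> with height \<open>C r\<close>. The columns decrease, so
  row \<open>h i\<close> of the diagram is an initial segment of \<open>{1..L}\<close>, and \<open>j i\<close> is its length.
\<close>

lemma staircase_assignment:
  fixes C :: "nat \<Rightarrow> nat"
  assumes "finite I"
    and anti: "\<And>r s. 1 \<le> r \<Longrightarrow> r \<le> s \<Longrightarrow> s \<le> L \<Longrightarrow> C s \<le> C r"
    and le: "\<And>r. 1 \<le> r \<Longrightarrow> r \<le> L \<Longrightarrow> C r \<le> card I"
  shows "\<exists>j. (\<forall>i\<in>I. j i \<le> L) \<and> (\<forall>r\<in>{1..L}. card {i\<in>I. r \<le> j i} = C r)"
proof -
  obtain h where h: "bij_betw h I {0..<card I}"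
    using ex_bij_betw_finite_nat assms(1) by blast
  define j where "j = (\<lambda>i. card {r\<in>{1..L}. h i < C r})"
  have level: "r \<le> j i \<longleftrightarrow> h i < C r" if r: "r \<in> {1..L}" for r i
  proof
    assume "h i < C r"
    then have "{1..r} \<subseteq> {r\<in>{1..L}. h i < C r}"
      using r anti by (auto intro: order.strict_trans2)
    then have "card {1..r} \<le> j i" unfolding j_def by (intro card_mono) auto
    then show "r \<le> j i" by simp
  next
    assume "r \<le> j i"
    show "h i < C r"
    proof (rule ccontr)
      assume "\<not> h i < C r"
      then have "{r\<in>{1..L}. h i < C r} \<subseteq> {1..<r}"
        using r anti by (auto simp: not_less) (meson leI le_trans not_le)
      then have "j i \<le> card {1..<r}" unfolding j_def by (intro card_mono) auto
      then show False using \<open>r \<le> j i\<close> r by auto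
    qed
  qed
  have "card {i\<in>I. r \<le> j i} = C r" if r: "r \<in> {1..L}" for r
  proof -
    have "h ` {i\<in>I. h i < C r} = {0..<C r}"
    proof
      show "{0..<C r} \<subseteq> h ` {i\<in>I. h i < C r}"
      proof
        fix c assume c: "c \<in> {0..<C r}"
        then have "c \<in> h ` I" using h le[of r] r by (auto simp: bij_betw_def)
        then show "c \<in> h ` {i\<in>I. h i < C r}" using c by auto
      qed
    qed auto
    moreover have "inj_on h {i\<in>I. h i < C r}"
      using h by (auto simp: bij_betw_def inj_on_def)
    ultimately have "card {i\<in>I. h i < C r} = C r"
      by (metis card_atLeastLessThan card_image diff_zero)
    then show ?thesis using level[OF r] by simp
  qed
  moreover have "j i \<le> L" for i
  proof -
    have "j i \<le> card {1..L}" unfolding j_def by (intro card_mono) auto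
    then show ?thesis by simp
  qed
  ultimately show ?thesis by blast
qed

text \<open>
  Votes are grouped by the list of alternatives above \<open>d\<close>, since rounding errors are paid once for
  each group, whatever its number of voters.
\<close>

definition types :: "'a profile \<Rightarrow> 'a \<Rightarrow> 'a list set" where
  "types P d = upper_part d ` set P"

definition holders :: "'a profile \<Rightarrow> 'a \<Rightarrow> 'a list \<Rightarrow> nat set" where
  "holders P d t = {i. i < length P \<and> upper_part d (P ! i) = t}"

lemma finite_types [simp]: "finite (types P d)"
  by (simp add: types_def)

lemma finite_holders [simp]: "finite (holders P d t)"
  by (simp add: holders_def)

lemma sum_by_type:
  "(\<Sum>i<length P. g (upper_part d (P ! i)) i) = (\<Sum>t\<in>types P d. \<Sum>i\<in>holders P d t. g t i)"
proof -
  have "(\<Sum>i<length P. g (upper_part d (P ! i)) i) =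
      (\<Sum>t\<in>types P d. \<Sum>i\<in>{i\<in>{..<length P}. upper_part d (P ! i) = t}. g (upper_part d (P ! i)) i)"
    by (rule sum.group[symmetric]) (auto simp: types_def)
  also have "\<dots> = (\<Sum>t\<in>types P d. \<Sum>i\<in>holders P d t. g t i)"
    by (intro sum.cong) (auto simp: holders_def)
  finally show ?thesis .
qed

text \<open>
  A plan need only specify how many votes of each type are lifted by at least \<open>r\<close>: overtaking \<open>b\<close>
  is a threshold condition on the lift, and the cost is the sum of these counts.
\<close>

lemma dodgson_score_le_staircases:
  assumes "is_profile A P" "d \<in> A"
    and anti: "\<And>t r s. 1 \<le> r \<Longrightarrow> r \<le> s \<Longrightarrow> s \<le> length t \<Longrightarrow> C t s \<le> C t r"
    and le: "\<And>t r. C t r \<le> card (holders P d t)"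
    and enough: "\<And>b. b \<in> A - {d} \<Longrightarrow>
      adv P b d \<le> 2 * int (\<Sum>t\<in>types P d. if 0 < lead t b then C t (lead t b) else 0)"
  shows "dodgson_score A P d \<le> (\<Sum>t\<in>types P d. \<Sum>r=1..length t. C t r)"
proof -
  have "\<forall>t. \<exists>j. (\<forall>i\<in>holders P d t. j i \<le> length t) \<and>
          (\<forall>r\<in>{1..length t}. card {i\<in>holders P d t. r \<le> j i} = C t r)"
    by (intro allI staircase_assignment finite_holders anti le)
  from choice[OF this] obtain J where
    "\<forall>t. (\<forall>i\<in>holders P d t. J t i \<le> length t) \<and>
       (\<forall>r\<in>{1..length t}. card {i\<in>holders P d t. r \<le> J t i} = C t r)" ..
  then have J: "\<And>t i. i \<in> holders P d t \<Longrightarrow> J t i \<le> length t"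
    "\<And>t r. r \<in> {1..length t} \<Longrightarrow> card {i\<in>holders P d t. r \<le> J t i} = C t r"
    by blast+
  define j where "j = (\<lambda>i. J (upper_part d (P ! i)) i)"
  have "lifting_plan A P d j"
    unfolding lifting_plan_def
  proof (intro conjI allI impI ballI)
    fix i assume "i < length P"
    then show "j i \<le> num_above (P ! i) d"
      using J(1)[of i "upper_part d (P ! i)"] by (simp add: j_def holders_def num_above_eq_length)
  next
    fix b assume b: "b \<in> A - {d}"
    have "card (lifted_votes P d j b) =
        (\<Sum>i<length P. if 0 < lead (upper_part d (P ! i)) b \<and>
           lead (upper_part d (P ! i)) b \<le> J (upper_part d (P ! i)) i then 1 else 0)"
      by (simp add: lifted_votes_def j_def sum.If_cases Int_def)
    also have "\<dots> = (\<Sum>t\<in>types P d. \<Sum>i\<in>holders P d t.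
                        if 0 < lead t b \<and> lead t b \<le> J t i then 1 else 0)"
      by (rule sum_by_type)
    also have "\<dots> = (\<Sum>t\<in>types P d. if 0 < lead t b then C t (lead t b) else 0)"
    proof (rule sum.cong)
      fix t
      have "0 < lead t b \<Longrightarrow> card {i\<in>holders P d t. lead t b \<le> J t i} = C t (lead t b)"
        using J(2) lead_le[of t b] by simp
      then show "(\<Sum>i\<in>holders P d t. if 0 < lead t b \<and> lead t b \<le> J t i then 1 else 0) =
          (if 0 < lead t b then C t (lead t b) else 0)"
        by (simp add: sum.If_cases Int_def)
    qed simp
    finally show "adv P b d \<le> 2 * int (card (lifted_votes P d j b))"
      using enough[OF b] by simp
  qed
  then have "dodgson_score A P d \<le> (\<Sum>i<length P. j i)"
    by (rule dodgson_score_le[OF assms(1,2)])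
  also have "\<dots> = (\<Sum>t\<in>types P d. \<Sum>i\<in>holders P d t. J t i)"
    unfolding j_def by (rule sum_by_type)
  also have "\<dots> = (\<Sum>t\<in>types P d. \<Sum>r=1..length t. C t r)"
  proof (rule sum.cong)
    fix t
    have "(\<Sum>i\<in>holders P d t. J t i) = (\<Sum>r=1..length t. card {i\<in>holders P d t. r \<le> J t i})"
      using J(1) by (intro sum_eq_sum_card_levels) auto
    then show "(\<Sum>i\<in>holders P d t. J t i) = (\<Sum>r=1..length t. C t r)"
      using J(2) by simp
  qed simp
  finally show ?thesis .
qed

section \<open>Cloned profiles\<close>

text \<open>
  The clones of vote \<open>i\<close> occupy the positions \<open>c\<close> with \<open>c div k = i\<close> of the cloned profile.
\<close>

lemma clone_profile_Cons: "clone_profile k (v # P) = replicate k v @ clone_profile k P"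
  by (simp add: clone_profile_def)

lemma length_clone_profile [simp]: "length (clone_profile k P) = length P * k"
  by (induction P) (simp_all add: clone_profile_Cons, simp add: clone_profile_def)

lemma set_clone_profile: "k \<ge> 1 \<Longrightarrow> set (clone_profile k P) = set P"
  by (auto simp: clone_profile_def)

lemma nth_clone_profile: "c < length P * k \<Longrightarrow> clone_profile k P ! c = P ! (c div k)"
proof (induction P arbitrary: c)
  case (Cons v P)
  show ?case
  proof (cases "c < k")
    case False
    moreover from this Cons.prems have "0 < k" by (cases k) auto
    ultimately show ?thesis
      using Cons.IH[of "c - k"] Cons.prems
      by (auto simp: clone_profile_Cons nth_append le_div_geq)
  qed (simp add: clone_profile_Cons nth_append)
qed simp

lemma is_profile_clone: "is_profile A P \<Longrightarrow> is_profile A (clone_profile k P)"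
  by (auto simp: is_profile_def clone_profile_def)

lemma sum_clone:
  fixes f :: "nat \<Rightarrow> 'b :: comm_semiring_1"
  shows "(\<Sum>c<n * k. f (c div k)) = of_nat k * (\<Sum>i<n. f i)"
proof -
  have "(\<Sum>c<n * k. f (c div k)) = (\<Sum>i<n. \<Sum>c=i * k..<i * k + k. f (c div k))"
    by (rule sum.nat_group[symmetric])
  also have "\<dots> = (\<Sum>i<n. \<Sum>c=i * k..<i * k + k. f i)"
  proof (intro sum.cong refl)
    fix i c assume "c \<in> {i * k..<i * k + k}"
    then have "c div k = i" by (intro div_nat_eqI) (auto simp: algebra_simps)
    then show "f (c div k) = f i" by simp
  qed
  finally show ?thesis by (simp add: sum_distrib_left)
qed

lemma card_clone:
  "card {c. c < length (clone_profile k P) \<and> R (clone_profile k P ! c)} =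
     k * card {i. i < length P \<and> R (P ! i)}"
proof -
  have "card {c. c < length P * k \<and> R (P ! (c div k))} =
      (\<Sum>c<length P * k. if R (P ! (c div k)) then 1 else 0)"
    by (simp add: sum.If_cases Int_def)
  also have "\<dots> = k * (\<Sum>i<length P. if R (P ! i) then 1 else 0)"
    using sum_clone[of "\<lambda>i. if R (P ! i) then 1 else 0 :: nat"] by simp
  also have "\<dots> = k * card {i. i < length P \<and> R (P ! i)}"
    by (simp add: sum.If_cases Int_def)
  finally show ?thesis by (simp add: nth_clone_profile cong: conj_cong)
qed

lemma num_prefer_clone: "num_prefer (clone_profile k P) a b = k * num_prefer P a b"
  unfolding num_prefer_def by (rule card_clone)

lemma adv_clone: "adv (clone_profile k P) a b = int k * adv P a b"
proof -
  have "max 0 (int k * z) = int k * max 0 z" for z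
    by (auto simp: max_def mult_le_0_iff zero_le_mult_iff)
  then show ?thesis
    by (simp add: adv_def num_prefer_clone right_diff_distrib[symmetric])
qed

lemma types_clone: "k \<ge> 1 \<Longrightarrow> types (clone_profile k P) d = types P d"
  by (simp add: types_def set_clone_profile)

lemma card_holders_clone: "card (holders (clone_profile k P) d t) = k * card (holders P d t)"
  unfolding holders_def by (rule card_clone)

section \<open>Fractional plans and their rounding\<close>

text \<open>
  Fractional plans are described by their tails: \<open>y i r\<close> is the fraction of vote \<open>i\<close> in which \<open>d\<close> is
  lifted by at least \<open>r\<close> positions. In these variables an overtaking condition reads off a single
  value from each vote. The right-hand sides are not rounded up, so plans for clones qualify too.
\<close>

definition tail_plan :: "'a set \<Rightarrow> 'a profile \<Rightarrow> 'a \<Rightarrow> (nat \<Rightarrow> nat \<Rightarrow> real) \<Rightarrow> bool" where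
  "tail_plan A P d y \<longleftrightarrow>
     (\<forall>i<length P. antimono (y i) \<and> range (y i) \<subseteq> {0..1}) \<and>
     (\<forall>b\<in>A - {d}. of_int (adv P b d) \<le> 2 * (\<Sum>i<length P.
        if 0 < lead (upper_part d (P ! i)) b then y i (lead (upper_part d (P ! i)) b) else 0))"

definition tail_cost :: "'a profile \<Rightarrow> 'a \<Rightarrow> (nat \<Rightarrow> nat \<Rightarrow> real) \<Rightarrow> real" where
  "tail_cost P d y = (\<Sum>i<length P. \<Sum>r=1..num_above (P ! i) d. y i r)"

lemma tail_cost_by_type:
  "tail_cost P d y = (\<Sum>t\<in>types P d. \<Sum>r=1..length t. \<Sum>i\<in>holders P d t. y i r)"
proof -
  have "tail_cost P d y = (\<Sum>i<length P. \<Sum>r=1..length (upper_part d (P ! i)). y i r)"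
    by (simp add: tail_cost_def num_above_eq_length)
  also have "\<dots> = (\<Sum>t\<in>types P d. \<Sum>i\<in>holders P d t. \<Sum>r=1..length t. y i r)"
    by (rule sum_by_type)
  also have "\<dots> = (\<Sum>t\<in>types P d. \<Sum>r=1..length t. \<Sum>i\<in>holders P d t. y i r)"
    by (intro sum.cong refl sum.swap)
  finally show ?thesis .
qed

text \<open>
  The ceilings of the tails added up over a type still decrease in \<open>r\<close>, cannot exceed the number of
  clones of that type, and can only increase the number of overtakings.
\<close>

lemma dodgson_score_clone_le_rounding:
  assumes "is_profile A P" "d \<in> A" "tail_plan A P d y" "q \<ge> 1"
  shows "real (dodgson_score A (clone_profile q P) d) \<le>
    (\<Sum>t\<in>types P d. \<Sum>r=1..length t. real_of_int \<lceil>real q * (\<Sum>i\<in>holders P d t. y i r)\<rceil>)"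
proof -
  define Y where "Y = (\<lambda>t r. real q * (\<Sum>i\<in>holders P d t. y i r))"
  define C where "C = (\<lambda>t r. nat \<lceil>Y t r\<rceil>)"
  have y: "antimono (y i)" "0 \<le> y i r" "y i r \<le> 1" if "i \<in> holders P d t" for i r t
    using assms(3) that by (auto simp: tail_plan_def holders_def image_subset_iff)
  have Y0: "0 \<le> Y t r" for t r
    unfolding Y_def using y(2) by (intro mult_nonneg_nonneg sum_nonneg) auto
  have C: "real (C t r) = real_of_int \<lceil>Y t r\<rceil>" for t r
    using Y0[of t r] by (simp add: C_def)
  have "dodgson_score A (clone_profile q P) d
      \<le> (\<Sum>t\<in>types (clone_profile q P) d. \<Sum>r=1..length t. C t r)"
  proof (rule dodgson_score_le_staircases)
    show "is_profile A (clone_profile q P)" using assms(1) by (rule is_profile_clone)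
    show "d \<in> A" by fact
    show "C t s \<le> C t r" if "r \<le> s" for t r s
    proof -
      have "Y t s \<le> Y t r"
        unfolding Y_def using y(1) that by (intro mult_left_mono sum_mono) (auto dest: antimonoD)
      then show ?thesis unfolding C_def by (intro nat_mono ceiling_mono)
    qed
    show "C t r \<le> card (holders (clone_profile q P) d t)" for t r
    proof -
      have "(\<Sum>i\<in>holders P d t. y i r) \<le> (\<Sum>i\<in>holders P d t. 1)"
        using y(3) by (intro sum_mono) auto
      then have "Y t r \<le> real q * real (card (holders P d t))"
        unfolding Y_def by (intro mult_left_mono) auto
      then have "\<lceil>Y t r\<rceil> \<le> int (q * card (holders P d t))"
        by (intro ceiling_le) simp
      then show ?thesis unfolding C_def card_holders_clone by linarith
    qed
    fix b assume b: "b \<in> A - {d}"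
    have "real_of_int (adv (clone_profile q P) b d) = real q * real_of_int (adv P b d)"
      by (simp add: adv_clone)
    also have "\<dots> \<le> real q * (2 * (\<Sum>i<length P.
        if 0 < lead (upper_part d (P ! i)) b then y i (lead (upper_part d (P ! i)) b) else 0))"
      using assms(3) b by (intro mult_left_mono) (auto simp: tail_plan_def)
    also have "(\<Sum>i<length P.
        if 0 < lead (upper_part d (P ! i)) b then y i (lead (upper_part d (P ! i)) b) else 0)
      = (\<Sum>t\<in>types P d. \<Sum>i\<in>holders P d t. if 0 < lead t b then y i (lead t b) else 0)"
      by (rule sum_by_type)
    also have "real q * (2 * \<dots>) = 2 * (\<Sum>t\<in>types P d. if 0 < lead t b then Y t (lead t b) else 0)"
      by (auto simp: Y_def sum_distrib_left intro!: sum.cong)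
    also have "\<dots> \<le> 2 * (\<Sum>t\<in>types P d. if 0 < lead t b then real (C t (lead t b)) else 0)"
      by (intro mult_left_mono sum_mono) (auto simp: C)
    also have "\<dots> = real_of_int (2 * int (\<Sum>t\<in>types P d. if 0 < lead t b then C t (lead t b) else 0))"
      by (auto intro!: sum.cong)
    finally show "adv (clone_profile q P) b d \<le>
        2 * int (\<Sum>t\<in>types (clone_profile q P) d. if 0 < lead t b then C t (lead t b) else 0)"
      using assms(4) by (simp only: of_int_le_iff types_clone)
  qed
  then have "real (dodgson_score A (clone_profile q P) d)
      \<le> real (\<Sum>t\<in>types P d. \<Sum>r=1..length t. C t r)"
    using assms(4) by (simp only: types_clone of_nat_le_iff)
  also have "\<dots> = (\<Sum>t\<in>types P d. \<Sum>r=1..length t. real_of_int \<lceil>Y t r\<rceil>)"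
    by (simp add: C)
  finally show ?thesis by (simp add: Y_def)
qed

lemma clone_profile_1 [simp]: "clone_profile (Suc 0) P = P"
  by (induction P) (simp_all add: clone_profile_def)

text \<open>
  Each ceiling costs at most 1, and a type \<open>t\<close> contributes \<open>length t\<close> of them.
\<close>

lemma dodgson_score_le_tail_cost:
  assumes "is_profile A P" "d \<in> A" "tail_plan A P d y"
  shows "real (dodgson_score A P d) \<le> tail_cost P d y + (\<Sum>t\<in>types P d. real (length t))"
proof -
  have "real (dodgson_score A P d) \<le>
    (\<Sum>t\<in>types P d. \<Sum>r=1..length t. real_of_int \<lceil>\<Sum>i\<in>holders P d t. y i r\<rceil>)"
    using dodgson_score_clone_le_rounding[OF assms, of 1] by simp
  also have "\<dots> \<le> (\<Sum>t\<in>types P d. \<Sum>r=1..length t. (\<Sum>i\<in>holders P d t. y i r) + 1)"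
    by (intro sum_mono) linarith
  also have "\<dots> = tail_cost P d y + (\<Sum>t\<in>types P d. real (length t))"
    unfolding tail_cost_by_type by (simp add: sum.distrib)
  finally show ?thesis .
qed

lemma dodgson_score_clone_le_tail_cost:
  assumes "is_profile A P" "d \<in> A" "tail_plan A P d y" "q \<ge> 1"
    and int: "\<And>i r. i < length P \<Longrightarrow> real q * y i r \<in> \<int>"
  shows "real (dodgson_score A (clone_profile q P) d) \<le> real q * tail_cost P d y"
proof -
  have "real_of_int \<lceil>real q * (\<Sum>i\<in>holders P d t. y i r)\<rceil> = real q * (\<Sum>i\<in>holders P d t. y i r)"
    for t r
  proof -
    have "real q * (\<Sum>i\<in>holders P d t. y i r) \<in> \<int>"
      unfolding sum_distrib_left using int by (intro Ints_sum) (auto simp: holders_def)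
    then show ?thesis by (auto elim: Ints_cases)
  qed
  then have "(\<Sum>t\<in>types P d. \<Sum>r=1..length t. real_of_int \<lceil>real q * (\<Sum>i\<in>holders P d t. y i r)\<rceil>)
      = (\<Sum>t\<in>types P d. \<Sum>r=1..length t. real q * (\<Sum>i\<in>holders P d t. y i r))"
    by (intro sum.cong refl)
  also have "\<dots> = real q * tail_cost P d y"
    by (simp only: tail_cost_by_type sum_distrib_left)
  finally show ?thesis
    using dodgson_score_clone_le_rounding[OF assms(1-4)] by (simp only:)
qed

section \<open>Averaging over clones\<close>

text \<open>
  Averaging an optimal plan for the clones over the clones of each vote. Advantages scale by \<open>k\<close>
  without rounding, which is why the plan need only reach half of the unrounded advantage.
\<close>

lemma clone_tail_plan:
  assumes "is_profile A P" "d \<in> A" "k \<ge> 1"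
  obtains y where "tail_plan A P d y"
    and "tail_cost P d y \<le> real (dodgson_score A (clone_profile k P) d) / real k"
proof -
  let ?Q = "clone_profile k P"
  obtain j where j: "lifting_plan A ?Q d j" "(\<Sum>c<length ?Q. j c) \<le> dodgson_score A ?Q d"
    using optimal_lifting_plan[OF is_profile_clone[OF assms(1)] assms(2)] by metis
  define block where "block = (\<lambda>i. {i * k..<i * k + k})"
  define y where "y = (\<lambda>i r. real (card {c\<in>block i. r \<le> j c}) / real k)"
  have blockD: "c < length ?Q \<and> ?Q ! c = P ! i" if "c \<in> block i" "i < length P" for c i
  proof -
    have c: "i * k \<le> c" "c < i * k + k" using that by (auto simp: block_def)
    then have div: "c div k = i" by (intro div_nat_eqI) (auto simp: algebra_simps)
    have "Suc i * k \<le> length P * k" using that(2) by (intro mult_le_mono1) simp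
    then have "c < length P * k" using c by simp
    then show ?thesis using div by (simp add: nth_clone_profile)
  qed
  have blocks: "(\<Sum>i<length P. \<Sum>c\<in>block i. f c) = (\<Sum>c<length ?Q. f c)" for f :: "nat \<Rightarrow> nat"
    unfolding block_def length_clone_profile by (rule sum.nat_group)
  have "tail_plan A P d y"
    unfolding tail_plan_def
  proof (intro conjI allI impI ballI)
    fix i
    show "antimono (y i)"
      unfolding y_def by (intro antimonoI divide_right_mono of_nat_mono card_mono)
        (auto simp: block_def)
    have "card {c\<in>block i. r \<le> j c} \<le> card (block i)" for r
      by (intro card_mono) (auto simp: block_def)
    then show "range (y i) \<subseteq> {0..1}"
      using assms(3) by (auto simp: y_def block_def)
  next
    fix b assume b: "b \<in> A - {d}"
    let ?l = "\<lambda>i. lead (upper_part d (P ! i)) b"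
    have "card (lifted_votes ?Q d j b) = (\<Sum>c<length ?Q.
        if 0 < lead (upper_part d (?Q ! c)) b \<and> lead (upper_part d (?Q ! c)) b \<le> j c then 1 else 0)"
      by (simp add: lifted_votes_def sum.If_cases Int_def)
    also have "\<dots> = (\<Sum>i<length P. \<Sum>c\<in>block i.
        if 0 < lead (upper_part d (?Q ! c)) b \<and> lead (upper_part d (?Q ! c)) b \<le> j c then 1 else 0)"
      by (rule blocks[symmetric])
    also have "\<dots> = (\<Sum>i<length P. if 0 < ?l i then card {c\<in>block i. ?l i \<le> j c} else 0)"
    proof (intro sum.cong refl)
      fix i assume i: "i \<in> {..<length P}"
      have "(\<Sum>c\<in>block i.
        if 0 < lead (upper_part d (?Q ! c)) b \<and> lead (upper_part d (?Q ! c)) b \<le> j c then 1 else 0)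
        = (\<Sum>c\<in>block i. if 0 < ?l i \<and> ?l i \<le> j c then 1 else 0 :: nat)"
      proof (rule sum.cong)
        fix c assume "c \<in> block i"
        then have "?Q ! c = P ! i" using blockD i by blast
        then show "(if 0 < lead (upper_part d (?Q ! c)) b \<and> lead (upper_part d (?Q ! c)) b \<le> j c
            then 1 else 0) = (if 0 < ?l i \<and> ?l i \<le> j c then 1 else 0 :: nat)" by simp
      qed simp
      also have "\<dots> = (if 0 < ?l i then card {c\<in>block i. ?l i \<le> j c} else 0)"
        by (simp add: block_def sum.If_cases Int_def)
      finally show "(\<Sum>c\<in>block i.
        if 0 < lead (upper_part d (?Q ! c)) b \<and> lead (upper_part d (?Q ! c)) b \<le> j c then 1 else 0)
        = (if 0 < ?l i then card {c\<in>block i. ?l i \<le> j c} else 0)" .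
    qed
    finally have "real (card (lifted_votes ?Q d j b)) =
        real k * (\<Sum>i<length P. if 0 < ?l i then y i (?l i) else 0)"
      using assms(3) by (simp add: y_def sum_distrib_left if_distrib[of "(*) _"] if_distrib[of real] cong: if_cong)
    moreover have "int k * adv P b d \<le> 2 * int (card (lifted_votes ?Q d j b))"
      using j(1) b by (auto simp: lifting_plan_def adv_clone)
    then have "real_of_int (int k * adv P b d) \<le> real_of_int (2 * int (card (lifted_votes ?Q d j b)))"
      by (simp only: of_int_le_iff)
    then have "real k * real_of_int (adv P b d) \<le> 2 * real (card (lifted_votes ?Q d j b))"
      by simp
    ultimately have "real k * real_of_int (adv P b d) \<le>
        real k * (2 * (\<Sum>i<length P. if 0 < ?l i then y i (?l i) else 0))"
      by simp
    then show "real_of_int (adv P b d) \<le> 2 * (\<Sum>i<length P. if 0 < ?l i then y i (?l i) else 0)"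
      using assms(3) by simp
  qed
  moreover have "tail_cost P d y \<le> real (dodgson_score A ?Q d) / real k"
  proof -
    have "(\<Sum>i<length P. \<Sum>r=1..num_above (P ! i) d. card {c\<in>block i. r \<le> j c}) =
        (\<Sum>i<length P. \<Sum>c\<in>block i. j c)"
    proof (rule sum.cong)
      fix i assume i: "i \<in> {..<length P}"
      have "j c \<le> num_above (P ! i) d" if "c \<in> block i" for c
        using j(1) blockD[OF that] i by (auto simp: lifting_plan_def)
      then show "(\<Sum>r=1..num_above (P ! i) d. card {c\<in>block i. r \<le> j c}) = (\<Sum>c\<in>block i. j c)"
        by (intro sum_eq_sum_card_levels[symmetric]) (auto simp: block_def)
    qed simp
    then have "(\<Sum>i<length P. \<Sum>r=1..num_above (P ! i) d. card {c\<in>block i. r \<le> j c})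
        \<le> dodgson_score A ?Q d"
      using j(2) blocks by simp
    then have "real (\<Sum>i<length P. \<Sum>r=1..num_above (P ! i) d. card {c\<in>block i. r \<le> j c})
        \<le> real (dodgson_score A ?Q d)"
      by (simp only: of_nat_le_iff)
    then have "real (\<Sum>i<length P. \<Sum>r=1..num_above (P ! i) d. card {c\<in>block i. r \<le> j c}) / real k
        \<le> real (dodgson_score A ?Q d) / real k"
      by (intro divide_right_mono) auto
    then show ?thesis by (simp add: tail_cost_def y_def sum_divide_distrib)
  qed
  ultimately show thesis by (rule that)
qed

section \<open>The number of types and the rounding loss\<close>

lemma card_distinct_lists:
  assumes "finite B"
  shows "finite {xs. distinct xs \<and> set xs \<subseteq> B}"
    and "real (card {xs. distinct xs \<and> set xs \<subseteq> B}) = fact (card B) * (\<Sum>k\<le>card B. 1 / fact k)"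
proof -
  let ?N = "card B"
  let ?D = "\<lambda>k. {xs. length xs = k \<and> distinct xs \<and> set xs \<subseteq> B}"
  have "length xs \<le> ?N" if "distinct xs" "set xs \<subseteq> B" for xs
    using card_mono[OF assms that(2)] distinct_card[OF that(1)] by simp
  then have U: "{xs. distinct xs \<and> set xs \<subseteq> B} = (\<Union>k\<le>?N. ?D k)" by auto
  have fin: "finite (?D k)" for k
    by (rule finite_subset[OF _ finite_lists_length_eq[OF assms, of k]]) auto
  show "finite {xs. distinct xs \<and> set xs \<subseteq> B}" unfolding U using fin by blast
  have "card {xs. distinct xs \<and> set xs \<subseteq> B} = (\<Sum>k\<le>?N. card (?D k))"
    unfolding U using fin by (intro card_UN_disjoint) auto
  then have "real (card {xs. distinct xs \<and> set xs \<subseteq> B}) = (\<Sum>k\<le>?N. real (card (?D k)))"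
    by simp
  also have "\<dots> = (\<Sum>k\<le>?N. fact ?N / fact (?N - k))"
  proof (rule sum.cong)
    fix k assume k: "k \<in> {..?N}"
    have "card (?D k) = \<Prod>{?N - k + 1..?N}"
      using card_lists_distinct_length_eq[OF assms] k by simp
    also have "\<dots> = fact ?N div fact (?N - k)"
      using fact_div_fact[of "?N - k" ?N] by simp
    finally show "real (card (?D k)) = fact ?N / fact (?N - k)"
      by (simp add: real_of_nat_div fact_dvd)
  qed simp
  also have "\<dots> = (\<Sum>k\<le>?N. fact ?N / fact k)"
    by (rule sum.reindex_bij_witness[of _ "\<lambda>k. ?N - k" "\<lambda>k. ?N - k"]) auto
  finally show "real (card {xs. distinct xs \<and> set xs \<subseteq> B}) = fact ?N * (\<Sum>k\<le>?N. 1 / fact k)"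
    by (simp add: sum_distrib_left)
qed

lemma sum_inverse_fact_less_exp: "(\<Sum>k\<le>n. 1 / fact k) < exp (1 :: real)"
proof -
  have "(\<Sum>k<Suc n. 1 / fact k) < (\<Sum>k. 1 / fact k :: real)"
    using summable_exp[of "1 :: real"]
    by (intro sum_less_suminf) (auto simp: field_simps)
  also have "\<dots> = exp 1" by (simp add: exp_def field_simps)
  finally show ?thesis by (simp only: lessThan_Suc_atMost)
qed

lemma sum_length_types_less:
  assumes "finite A" "is_profile A P" "d \<in> A" "card A \<ge> 2"
  shows "(\<Sum>t\<in>types P d. real (length t)) < fact (card A - 1) * real (card A - 1) * exp 1"
proof -
  let ?B = "A - {d}" and ?N = "card A - 1"
  let ?D = "{xs. distinct xs \<and> set xs \<subseteq> ?B}"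
  have B: "finite ?B" "card ?B = ?N" using assms by auto
  have sub: "types P d \<subseteq> ?D"
  proof
    fix t assume "t \<in> types P d"
    then obtain v where v: "v \<in> set P" "t = takeWhile (\<lambda>x. x \<noteq> d) v"
      by (auto simp: types_def upper_part_def)
    have "distinct v" "set v = A"
      using v(1) assms(2) by (auto simp: is_profile_def permutations_of_set_def)
    then show "t \<in> ?D" using v(2) by (auto dest: set_takeWhileD)
  qed
  have "(\<Sum>t\<in>types P d. real (length t)) \<le> (\<Sum>t\<in>types P d. real ?N)"
  proof (rule sum_mono)
    fix t assume "t \<in> types P d"
    then have "distinct t" "set t \<subseteq> ?B" using sub by auto
    then show "real (length t) \<le> real ?N"
      using card_mono[OF B(1), of "set t"] B(2) distinct_card[of t] by simp
  qed
  also have "\<dots> \<le> real (card ?D) * real ?N"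
    using card_mono[OF card_distinct_lists(1)[OF B(1)] sub] by (simp add: mult_right_mono)
  also have "\<dots> = fact ?N * (\<Sum>k\<le>?N. 1 / fact k) * real ?N"
    using card_distinct_lists(2)[OF B(1)] B(2) by simp
  also have "\<dots> < fact ?N * exp 1 * real ?N"
    using assms(4) by (intro mult_strict_right_mono mult_strict_left_mono sum_inverse_fact_less_exp) auto
  finally show ?thesis by (simp add: mult_ac)
qed

text \<open>
  The loss does not depend on the number of clones, so the bound passes to the infimum.
\<close>

lemma dodgson_score_le_dc_score:
  assumes "is_profile A P" "d \<in> A"
  shows "real (dodgson_score A P d) - (\<Sum>t\<in>types P d. real (length t)) \<le> dc_score A P d"
  unfolding dc_score_def
proof (rule cINF_greatest)
  fix k :: nat assume "k \<in> {1..}"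
  then obtain y where y: "tail_plan A P d y"
    "tail_cost P d y \<le> real (dodgson_score A (clone_profile k P) d) / real k"
    using clone_tail_plan[OF assms, of k] by (metis atLeast_iff)
  show "real (dodgson_score A P d) - (\<Sum>t\<in>types P d. real (length t))
      \<le> real (dodgson_score A (clone_profile k P) d) / real k"
    using dodgson_score_le_tail_cost[OF assms y(1)] y(2) by linarith
qed auto

lemma dc_score_le_clone:
  "k \<ge> 1 \<Longrightarrow> dc_score A P d \<le> real (dodgson_score A (clone_profile k P) d) / real k"
  unfolding dc_score_def by (intro cINF_lower bdd_belowI2[of _ 0]) auto

section \<open>The relaxed score\<close>

lemma common_denominator:
  fixes S :: "rat set"
  assumes "finite S"
  shows "\<exists>k::nat. k \<ge> 1 \<and> (\<forall>q\<in>S. of_nat k * q \<in> \<int>)"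
  using assms
proof (induction S)
  case empty
  then show ?case by auto
next
  case (insert q S)
  then obtain k :: nat where k: "k \<ge> 1" "\<And>r. r \<in> S \<Longrightarrow> of_nat k * r \<in> \<int>" by auto
  obtain a b where ab: "quotient_of q = (a, b)" by fastforce
  have b: "b > 0" using quotient_of_denom_pos ab by blast
  have q: "q = of_int a / of_int b" using quotient_of_div ab by blast
  define l where "l = nat b * k"
  have lb: "of_nat l = (of_int b :: rat) * of_nat k"
    using b by (simp add: l_def)
  have "of_nat l * q = of_nat k * of_int a" using b by (simp add: lb q)
  moreover have "of_nat l * r \<in> \<int>" if "r \<in> S" for r
    using k(2)[OF that] by (simp add: lb mult.assoc)
  moreover have "l \<ge> 1" using b k(1) by (simp add: l_def)
  ultimately show ?case by (intro exI[of _ l]) auto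
qed

text \<open>
  Summation by parts: the term for \<open>j\<close> is counted in the tails starting at \<open>1, ..., j\<close>. With \<open>f j\<close> the
  fraction lifted by \<open>j\<close> it identifies the cost of the linear program with the sum of the tails.
\<close>

lemma sum_tails:
  fixes f :: "nat \<Rightarrow> 'b :: comm_ring_1"
  shows "(\<Sum>r=1..n. \<Sum>j=r..n. f j) = (\<Sum>j\<le>n. of_nat j * f j)"
proof (induction n)
  case (Suc n)
  have "(\<Sum>r=1..Suc n. \<Sum>j=r..Suc n. f j) = (\<Sum>r=1..Suc n. (\<Sum>j=r..n. f j) + f (Suc n))"
    by (intro sum.cong refl) simp
  also have "\<dots> = (\<Sum>r=1..n. \<Sum>j=r..n. f j) + of_nat (Suc n) * f (Suc n)"
    by (simp add: sum.distrib algebra_simps)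
  finally show ?case using Suc by simp
qed simp

lemma sum_raises_over:
  assumes "v \<in> permutations_of_set A" "d \<in> A" "b \<in> A" "b \<noteq> d"
  shows "(\<Sum>j\<le>n. raises_over v d j b * f j) =
    (if 0 < lead (upper_part d v) b then (\<Sum>j=lead (upper_part d v) b..n. f j) else 0)"
proof -
  have "(\<Sum>j\<le>n. raises_over v d j b * f j) =
      (\<Sum>j\<le>n. if 0 < lead (upper_part d v) b \<and> lead (upper_part d v) b \<le> j then f j else 0)"
    by (intro sum.cong) (auto simp: raises_over_iff_lead[OF assms])
  also have "\<dots> = (if 0 < lead (upper_part d v) b then
      (\<Sum>j\<in>{..n} \<inter> {j. lead (upper_part d v) b \<le> j}. f j) else 0)"
    by (simp add: sum.If_cases)
  also have "{..n} \<inter> {j. lead (upper_part d v) b \<le> j} = {lead (upper_part d v) b..n}" by auto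
  finally show ?thesis .
qed

lemma adv_le_required_swaps: "of_int (adv P b d) \<le> 2 * (of_int (required_swaps P b d) :: rat)"
proof -
  have "of_int (adv P b d) / (2 :: rat) \<le> of_int (required_swaps P b d)"
    unfolding required_swaps_def by (rule le_of_int_ceiling)
  then show ?thesis by simp
qed

text \<open>
  The tails of a feasible solution form a fractional plan of the same cost, and for a common
  denominator \<open>k\<close> of its entries the rounding for \<open>k\<close> clones is exact.
\<close>

lemma dc_score_le_dr_cost:
  assumes "is_profile A P" "d \<in> A" "dr_feasible A P d x"
  shows "dc_score A P d \<le> of_rat (dr_cost P d x)"
proof -
  let ?L = "\<lambda>i. num_above (P ! i) d"
  define y :: "nat \<Rightarrow> nat \<Rightarrow> real" where "y = (\<lambda>i r. of_rat (\<Sum>j=r..?L i. x i j))"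
  have pos: "0 \<le> x i j" if "i < length P" "j \<le> ?L i" for i j
    using assms(3) that by (simp add: dr_feasible_def)
  have one: "(\<Sum>j\<le>?L i. x i j) = 1" if "i < length P" for i
    using assms(3) that by (simp add: dr_feasible_def)
  have plan: "tail_plan A P d y"
    unfolding tail_plan_def
  proof (intro conjI allI impI ballI)
    fix i assume i: "i < length P"
    show "antimono (y i)"
      unfolding y_def by (intro antimonoI of_rat_less_eq[THEN iffD2] sum_mono2) (auto simp: pos[OF i])
    have "(\<Sum>j=r..?L i. x i j) \<le> (\<Sum>j\<le>?L i. x i j)" for r
      by (intro sum_mono2) (auto simp: pos[OF i])
    moreover have "0 \<le> (\<Sum>j=r..?L i. x i j)" for r
      by (intro sum_nonneg) (auto simp: pos[OF i])
    ultimately show "range (y i) \<subseteq> {0..1}"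
      using one[OF i] by (auto simp: y_def)
  next
    fix b assume b: "b \<in> A - {d}"
    let ?l = "\<lambda>i. lead (upper_part d (P ! i)) b"
    have "of_int (adv P b d) \<le> 2 * (of_int (required_swaps P b d) :: rat)"
      by (rule adv_le_required_swaps)
    also have "\<dots> \<le> 2 * (\<Sum>i<length P. \<Sum>j\<le>?L i. raises_over (P ! i) d j b * x i j)"
      using assms(3) b by (simp add: dr_feasible_def)
    also have "\<dots> = 2 * (\<Sum>i<length P. if 0 < ?l i then (\<Sum>j=?l i..?L i. x i j) else 0)"
      using b sum_raises_over[OF profile_nth[OF assms(1)] assms(2)] by simp
    finally have "(of_rat (of_int (adv P b d)) :: real) \<le>
        of_rat (2 * (\<Sum>i<length P. if 0 < ?l i then (\<Sum>j=?l i..?L i. x i j) else 0))"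
      by (simp only: of_rat_less_eq)
    also have "\<dots> = 2 * (\<Sum>i<length P. if 0 < ?l i then y i (?l i) else 0)"
      by (auto simp: y_def of_rat_mult of_rat_sum intro!: sum.cong)
    finally show "of_int (adv P b d) \<le> 2 * (\<Sum>i<length P. if 0 < ?l i then y i (?l i) else 0)"
      by simp
  qed
  have cost: "tail_cost P d y = of_rat (dr_cost P d x)"
    unfolding tail_cost_def y_def dr_cost_def of_rat_sum[symmetric] sum_tails ..
  let ?S = "\<Union>i<length P. x i ` {..?L i}"
  obtain k :: nat where k: "k \<ge> 1" "\<And>q. q \<in> ?S \<Longrightarrow> of_nat k * q \<in> \<int>"
    using common_denominator[of ?S] by auto
  have "real k * y i r \<in> \<int>" if i: "i < length P" for i r
  proof -
    have "of_nat k * (\<Sum>j=r..?L i. x i j) \<in> \<int>"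
      unfolding sum_distrib_left using i by (intro Ints_sum k(2)) auto
    then obtain z where "of_nat k * (\<Sum>j=r..?L i. x i j) = of_int z" by (auto elim: Ints_cases)
    then have "of_rat (of_nat k * (\<Sum>j=r..?L i. x i j)) = real_of_int z"
      by (metis of_rat_of_int_eq)
    then show ?thesis by (simp add: y_def of_rat_mult)
  qed
  then have "real (dodgson_score A (clone_profile k P) d) \<le> real k * tail_cost P d y"
    using dodgson_score_clone_le_tail_cost[OF assms(1,2) plan k(1)] by blast
  then have "real (dodgson_score A (clone_profile k P) d) / real k \<le> tail_cost P d y"
    using k(1) by (simp add: divide_le_eq mult.commute)
  then show ?thesis using dc_score_le_clone[OF k(1), of A P d] cost by linarith
qed

text \<open>
  A count that is at least half the advantage is also at least its ceiling, so integer
  plans satisfy the rounded-up requirements.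
\<close>

lemma dr_feasible_of_lifting_plan:
  assumes "is_profile A P" "d \<in> A" "lifting_plan A P d j"
  defines "x \<equiv> \<lambda>i r. if r = j i then 1 else 0"
  shows "dr_feasible A P d x" and "dr_cost P d x = of_nat (\<Sum>i<length P. j i)"
proof -
  let ?L = "\<lambda>i. num_above (P ! i) d"
  have jL: "j i \<le> ?L i" if "i < length P" for i
    using assms(3) that by (simp add: lifting_plan_def)
  show "dr_cost P d x = of_nat (\<Sum>i<length P. j i)"
    using jL by (simp add: dr_cost_def x_def if_distrib cong: if_cong)
  show "dr_feasible A P d x"
    unfolding dr_feasible_def
  proof (intro conjI allI impI ballI)
    fix i assume "i < length P"
    then show "(\<Sum>r\<le>?L i. x i r) = 1" using jL by (simp add: x_def)
  next
    fix b assume b: "b \<in> A - {d}"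
    let ?l = "\<lambda>i. lead (upper_part d (P ! i)) b"
    have "(\<Sum>i<length P. \<Sum>r\<le>?L i. raises_over (P ! i) d r b * x i r) =
        (\<Sum>i<length P. raises_over (P ! i) d (j i) b)"
      using jL by (intro sum.cong) (simp_all add: x_def if_distrib cong: if_cong)
    also have "\<dots> = (\<Sum>i<length P. if 0 < ?l i \<and> ?l i \<le> j i then 1 else 0)"
      using b raises_over_iff_lead[OF profile_nth[OF assms(1)] assms(2)] by simp
    also have "\<dots> = of_nat (card (lifted_votes P d j b))"
      by (simp add: lifted_votes_def sum.If_cases Int_def)
    finally have eq: "(\<Sum>i<length P. \<Sum>r\<le>?L i. raises_over (P ! i) d r b * x i r) =
        of_nat (card (lifted_votes P d j b))" .
    have "adv P b d \<le> 2 * int (card (lifted_votes P d j b))"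
      using assms(3) b by (auto simp: lifting_plan_def)
    then have "of_int (adv P b d) \<le> (of_int (2 * int (card (lifted_votes P d j b))) :: rat)"
      by (simp only: of_int_le_iff)
    then have "required_swaps P b d \<le> int (card (lifted_votes P d j b))"
      unfolding required_swaps_def by (intro ceiling_le) simp
    then have "(of_int (required_swaps P b d) :: rat) \<le> of_int (int (card (lifted_votes P d j b)))"
      by (simp only: of_int_le_iff)
    then show "of_int (required_swaps P b d) \<le>
        (\<Sum>i<length P. \<Sum>r\<le>?L i. raises_over (P ! i) d r b * x i r)"
      using eq by simp
  qed (simp add: x_def)
qed

lemma dr_score_le_dodgson_score:
  assumes "is_profile A P" "d \<in> A"
  shows "dr_score A P d \<le> real (dodgson_score A P d)"
proof -
  obtain j where j: "lifting_plan A P d j" "(\<Sum>i<length P. j i) \<le> dodgson_score A P d"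
    using optimal_lifting_plan[OF assms] by metis
  define x :: "nat \<Rightarrow> nat \<Rightarrow> rat" where "x = (\<lambda>i r. if r = j i then 1 else 0)"
  have x: "dr_feasible A P d x" "dr_cost P d x = of_nat (\<Sum>i<length P. j i)"
    unfolding x_def using dr_feasible_of_lifting_plan[OF assms j(1)] by blast+
  have "0 \<le> dr_cost P d z" if "dr_feasible A P d z" for z
    using that unfolding dr_cost_def by (intro sum_nonneg) (auto simp: dr_feasible_def)
  then have "bdd_below {of_rat (dr_cost P d z) :: real | z. dr_feasible A P d z}"
    by (intro bdd_belowI[of _ 0]) auto
  then have "dr_score A P d \<le> of_rat (dr_cost P d x)"
    unfolding dr_score_def using x(1) by (intro cInf_lower) auto
  also have "\<dots> = real (\<Sum>i<length P. j i)" unfolding x(2) by (rule of_rat_of_nat_eq)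
  also have "\<dots> \<le> real (dodgson_score A P d)" using j(2) by (simp only: of_nat_le_iff)
  finally show ?thesis .
qed

lemma dc_score_le_dr_score:
  assumes "is_profile A P" "d \<in> A"
  shows "dc_score A P d \<le> dr_score A P d"
  unfolding dr_score_def
proof (rule cInf_greatest)
  obtain j where "lifting_plan A P d j"
    using full_lifting_plan[OF assms] by blast
  then show "{of_rat (dr_cost P d x) :: real | x. dr_feasible A P d x} \<noteq> {}"
    using dr_feasible_of_lifting_plan(1)[OF assms] by blast
qed (use dc_score_le_dr_cost[OF assms] in auto)

theorem theorem3p5:
  fixes A :: "'a set" and P :: "'a profile" and m n :: nat and d :: 'a
  assumes "finite A" and "card A = m"
    and "is_profile A P" and "length P = n"
    and "d \<in> A"
  shows "(m \<ge> 2 \<longrightarrow>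
            real (dodgson_score A P d) - fact (m - 1) * real (m - 1) * exp 1 < dc_score A P d) \<and>
         dc_score A P d \<le> dr_score A P d \<and>
         dr_score A P d \<le> real_of_int (d_and_score A P d) \<and>
         real_of_int (d_and_score A P d) \<le> real (dodgson_score A P d)"
proof (intro conjI impI)
  assume "m \<ge> 2"
  then show "real (dodgson_score A P d) - fact (m - 1) * real (m - 1) * exp 1 < dc_score A P d"
    using sum_length_types_less[OF assms(1,3,5)] dodgson_score_le_dc_score[OF assms(3,5)] assms(2)
    by simp
next
  show "dc_score A P d \<le> dr_score A P d"
    using assms(3,5) by (rule dc_score_le_dr_score)
  show "dr_score A P d \<le> real_of_int (d_and_score A P d)"
    unfolding d_and_score_def by (rule le_of_int_ceiling)
  have "d_and_score A P d \<le> int (dodgson_score A P d)"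
    unfolding d_and_score_def
    using dr_score_le_dodgson_score[OF assms(3,5)] by (intro ceiling_le) simp
  then show "real_of_int (d_and_score A P d) \<le> real (dodgson_score A P d)"
    by linarith
qed

end
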